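(* Let $\mathbb K$ be $\mathbb R$, $\mathbb C$, or an arbitrary uncountable field, let $m,r\ge 1$ and $N,M\ge 0$ be integers, and let $$D^u=(D^u_{ij})_{1\le i,j\le r}:\mathbb K[\underline x,\underline t]^{\oplus r}\longrightarrow \mathbb K[\underline x,\underline t]^{\oplus r},\qquad D^u_{ij}=\sum_{|I|\le N}\Big(\sum_{|J|\le M}t_{I,J,i,j}\,\underline x^{J}\Big)\frac{\partial^{|I|}}{\partial \underline x^{I}},$$ be the universal family of linear partial differential operators of order $\le N$ in $\underline x=(x_1,\dots,x_m)$ on $\mathbb K[\underline x]^{\oplus r}$ whose polynomial coefficients have degree $\le M$, where the $t_{I,J,i,j}$ are independent parameters. Let $K$ be the number of parameters $t_{I,J,i,j}$, and for $\underline c\in\mathbb K^{K}$ let $D_{\underline c}:\mathbb K[\underline x]^{\oplus r}\to\mathbb K[\underline x]^{\oplus r}$ be the operator obtained by substituting $\underline t=\underline c$. Then for very general $\underline c\in\mathbb K^{K}$ one has $\ker(D_{\underline c})=0$. In particular, if $m=1$ (the case of systems of ordinary linear differential operators), for very general $\underline c$ the operator $D_{\underline c}$ has no nonzero algebraic (i.e. polynomial) solution in $\mathbb K[x_1]^{\oplus r}$.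
   Context: Multi-index notation: $I,J\in\mathbb N_0^m$, $|I|=i_1+\dots+i_m$, $\underline x^J=x_1^{j_1}\cdots x_m^{j_m}$, $\partial^{|I|}/\partial\underline x^I$ is the corresponding iterated partial derivative. "For very general $\underline c\in\mathbb K^K$" means: for all $\underline c\in \mathbb K^K$ outside a countable union of proper Zariski-closed subsets of the affine space $\mathbb A^K_{\mathbb K}$. *)

theory Defs
  imports Complex_Main "HOL-Library.Poly_Mapping" "HOL-Library.FuncSet" "HOL-Library.Countable_Set"
begin

text \<open>
  A polynomial over \<open>'a\<close> in variables indexed by \<open>'v\<close> is an element of the monoid algebra
  \<open>('v \<Rightarrow>\<^sub>0 nat) \<Rightarrow>\<^sub>0 'a\<close>; its Poly_Mapping.keys are the exponent vectors, its product is convolution.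
  The variables \<open>x\<^sub>1, \<dots>, x\<^sub>m\<close> are indexed by \<open>0, \<dots>, m - 1\<close>.
\<close>

type_synonym ('v, 'a) mpoly = "('v \<Rightarrow>\<^sub>0 nat) \<Rightarrow>\<^sub>0 'a"

definition polys :: "'v set \<Rightarrow> ('v, 'a::comm_semiring_1) mpoly set" where
  "polys V = {p. \<forall>e\<in>Poly_Mapping.keys p. Poly_Mapping.keys e \<subseteq> V}"

definition var :: "'v \<Rightarrow> ('v, 'a::comm_semiring_1) mpoly" where
  "var v = Poly_Mapping.single (Poly_Mapping.single v 1) 1"

definition peval :: "('v \<Rightarrow> 'a) \<Rightarrow> ('v, 'a::comm_semiring_1) mpoly \<Rightarrow> 'a" where
  "peval c p = (\<Sum>e\<in>Poly_Mapping.keys p. Poly_Mapping.lookup p e * (\<Prod>v\<in>Poly_Mapping.keys e. c v ^ Poly_Mapping.lookup e v))"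

text \<open>The points of the affine space with coordinates indexed by \<open>V\<close>.\<close>

definition affine_space :: "'v set \<Rightarrow> ('v \<Rightarrow> 'a) set" where
  "affine_space V = V \<rightarrow>\<^sub>E UNIV"

definition zariski_closed :: "'v set \<Rightarrow> ('v \<Rightarrow> 'a::field) set \<Rightarrow> bool" where
  "zariski_closed V Z \<longleftrightarrow>
     (\<exists>S \<subseteq> polys V. Z = {c \<in> affine_space V. \<forall>f\<in>S. peval c f = 0})"

text \<open>
  Properness is required of the set of rational points; over an infinite field this is the same
  as properness of the closed subscheme.
\<close>

definition very_general :: "'v set \<Rightarrow> (('v \<Rightarrow> 'a::field) \<Rightarrow> bool) \<Rightarrow> bool" where
  "very_general V Q \<longleftrightarrow>
     (\<exists>\<Z>. countable \<Z> \<and>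
          (\<forall>Z\<in>\<Z>. zariski_closed V Z \<and> Z \<noteq> affine_space V) \<and>
          (\<forall>c \<in> affine_space V - \<Union>\<Z>. Q c))"

text \<open>
  Formal partial derivative, from \<open>x\<^sup>e \<mapsto> e\<^sub>k x\<^bsup>e - 1\<^sub>k\<^esup>\<close>; the truncated
  subtraction on exponents is harmless because for \<open>e\<^sub>k = 0\<close> the coefficient is zero.
\<close>

definition pd :: "'v \<Rightarrow> ('v, 'a::comm_semiring_1) mpoly \<Rightarrow> ('v, 'a) mpoly" where
  "pd k p = (\<Sum>e\<in>Poly_Mapping.keys p. Poly_Mapping.single (e - Poly_Mapping.single k 1)
                          (of_nat (Poly_Mapping.lookup e k) * Poly_Mapping.lookup p e))"

definition pd_iter :: "nat \<Rightarrow> (nat \<Rightarrow>\<^sub>0 nat) \<Rightarrow> (nat, 'a::comm_semiring_1) mpoly \<Rightarrow> (nat, 'a) mpoly" where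
  "pd_iter m I p = fold (\<lambda>k. pd k ^^ Poly_Mapping.lookup I k) [0..<m] p"

definition multi_indices :: "nat \<Rightarrow> nat \<Rightarrow> (nat \<Rightarrow>\<^sub>0 nat) set" where
  "multi_indices m d = {I. Poly_Mapping.keys I \<subseteq> {..<m} \<and> (\<Sum>k<m. Poly_Mapping.lookup I k) \<le> d}"

text \<open>
  An \<open>r \<times> r\<close> matrix of differential operators is given by its coefficients: \<open>A I i j\<close> is the
  coefficient of \<open>\<partial>\<^sup>I\<close> in the entry \<open>(i, j)\<close>. Elements of \<open>R[x]\<^sup>r\<close> are extensional functions
  on \<open>{..<r}\<close>.
\<close>

definition poly_vectors :: "nat \<Rightarrow> nat \<Rightarrow> (nat \<Rightarrow> (nat, 'a::comm_semiring_1) mpoly) set" where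
  "poly_vectors m r = {..<r} \<rightarrow>\<^sub>E polys {..<m}"

definition zero_vector :: "nat \<Rightarrow> nat \<Rightarrow> (nat, 'a::comm_semiring_1) mpoly" where
  "zero_vector r = (\<lambda>i\<in>{..<r}. 0)"

definition diff_op ::
  "nat \<Rightarrow> nat \<Rightarrow> nat \<Rightarrow> ((nat \<Rightarrow>\<^sub>0 nat) \<Rightarrow> nat \<Rightarrow> nat \<Rightarrow> (nat, 'a::comm_semiring_1) mpoly)
     \<Rightarrow> (nat \<Rightarrow> (nat, 'a) mpoly) \<Rightarrow> (nat \<Rightarrow> (nat, 'a) mpoly)" where
  "diff_op m r N A P =
     (\<lambda>i\<in>{..<r}. \<Sum>j<r. \<Sum>I\<in>multi_indices m N. A I i j * pd_iter m I (P j))"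

definition op_kernel ::
  "nat \<Rightarrow> nat \<Rightarrow> ((nat \<Rightarrow> (nat, 'a::comm_semiring_1) mpoly) \<Rightarrow> (nat \<Rightarrow> (nat, 'a) mpoly))
     \<Rightarrow> (nat \<Rightarrow> (nat, 'a) mpoly) set" where
  "op_kernel m r D = {P \<in> poly_vectors m r. D P = zero_vector r}"

text \<open>The index \<open>(I, J, i, j)\<close> of the parameter \<open>t\<^sub>I\<^sub>,\<^sub>J\<^sub>,\<^sub>i\<^sub>,\<^sub>j\<close>.\<close>

type_synonym param = "(nat \<Rightarrow>\<^sub>0 nat) \<times> (nat \<Rightarrow>\<^sub>0 nat) \<times> nat \<times> nat"

definition params :: "nat \<Rightarrow> nat \<Rightarrow> nat \<Rightarrow> nat \<Rightarrow> param set" where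
  "params m r N M = multi_indices m N \<times> multi_indices m M \<times> {..<r} \<times> {..<r}"

text \<open>
  \<open>K[x, t]\<close> is represented as \<open>K[t][x]\<close>, on which the derivations \<open>pd k\<close> are \<open>K[t]\<close>-linear.
\<close>

definition universal_coeff ::
  "nat \<Rightarrow> nat \<Rightarrow> (nat \<Rightarrow>\<^sub>0 nat) \<Rightarrow> nat \<Rightarrow> nat \<Rightarrow> (nat, (param, 'a::comm_semiring_1) mpoly) mpoly" where
  "universal_coeff m M I i j =
     (\<Sum>J\<in>multi_indices m M. Poly_Mapping.single J (var (I, J, i, j)))"

definition universal_op ::
  "nat \<Rightarrow> nat \<Rightarrow> nat \<Rightarrow> nat \<Rightarrow> (nat \<Rightarrow> (nat, (param, 'a::comm_semiring_1) mpoly) mpoly)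
     \<Rightarrow> (nat \<Rightarrow> (nat, (param, 'a) mpoly) mpoly)" where
  "universal_op m r N M = diff_op m r N (universal_coeff m M)"

definition subst_params ::
  "(param \<Rightarrow> 'a) \<Rightarrow> (nat, (param, 'a::comm_semiring_1) mpoly) mpoly \<Rightarrow> (nat, 'a) mpoly" where
  "subst_params c p = Poly_Mapping.map (peval c) p"

definition special_op ::
  "nat \<Rightarrow> nat \<Rightarrow> nat \<Rightarrow> nat \<Rightarrow> (param \<Rightarrow> 'a::comm_semiring_1)
     \<Rightarrow> (nat \<Rightarrow> (nat, 'a) mpoly) \<Rightarrow> (nat \<Rightarrow> (nat, 'a) mpoly)" where
  "special_op m r N M c = diff_op m r N (\<lambda>I i j. subst_params c (universal_coeff m M I i j))"

lemma finite_multi_indices: "finite (multi_indices m d)"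
proof -
  have "Poly_Mapping.lookup ` multi_indices m d \<subseteq> {f. \<forall>x. (x \<in> {..<m} \<longrightarrow> f x \<in> {..d}) \<and> (x \<notin> {..<m} \<longrightarrow> f x = 0)}"
  proof (rule image_subsetI, simp only: mem_Collect_eq)
    fix I assume "I \<in> multi_indices m d"
    then have a: "Poly_Mapping.keys I \<subseteq> {..<m}" "(\<Sum>k<m. Poly_Mapping.lookup I k) \<le> d" by (auto simp: multi_indices_def)
    have "Poly_Mapping.lookup I x \<le> d" if "x < m" for x
      using member_le_sum[of x "{..<m}" "Poly_Mapping.lookup I"] a that by auto
    moreover have "Poly_Mapping.lookup I x = 0" if "\<not> x < m" for x
      using a(1) that by (meson in_keys_iff lessThan_iff subsetD)
    ultimately show "\<forall>x. (x \<in> {..<m} \<longrightarrow> Poly_Mapping.lookup I x \<in> {..d}) \<and> (x \<notin> {..<m} \<longrightarrow> Poly_Mapping.lookup I x = 0)" by auto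
  qed
  then have "finite (Poly_Mapping.lookup ` multi_indices m d)"
    by (rule finite_subset) (rule finite_set_of_finite_funs; simp)
  moreover have "inj_on Poly_Mapping.lookup (multi_indices m d)"
    by (rule inj_onI) (rule poly_mapping_eqI, simp)
  ultimately show ?thesis using finite_imageD by blast
qed

lemma poly_mapping_sum_monomials: "(\<Sum>a\<in>Poly_Mapping.keys p. Poly_Mapping.single a (Poly_Mapping.lookup p a)) = p"
  by (rule poly_mapping_eqI) (simp add: lookup_sum lookup_single when_def in_keys_iff)

lemma peval_superset:
  assumes "finite A" "Poly_Mapping.keys p \<subseteq> A"
  shows "peval c p = (\<Sum>e\<in>A. Poly_Mapping.lookup p e * (\<Prod>v\<in>Poly_Mapping.keys e. c v ^ Poly_Mapping.lookup e v))"
  unfolding peval_def by (rule sum.mono_neutral_left) (use assms in \<open>auto simp: in_keys_iff\<close>)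

lemma peval_zero [simp]: "peval c 0 = 0" by (simp add: peval_def)

lemma peval_add: "peval c (p + q) = peval c p + peval c q"
proof -
  let ?A = "Poly_Mapping.keys p \<union> Poly_Mapping.keys q"
  have "Poly_Mapping.keys (p + q) \<subseteq> ?A" by (rule Poly_Mapping.keys_add)
  then show ?thesis
    by (simp add: peval_superset[of ?A] lookup_add distrib_right sum.distrib)
qed

lemma peval_sum: "peval c (sum f A) = (\<Sum>a\<in>A. peval c (f a))"
  by (induction A rule: infinite_finite_induct) (auto simp: peval_add)

lemma peval_single: "peval c (Poly_Mapping.single e a) = a * (\<Prod>v\<in>Poly_Mapping.keys e. c v ^ Poly_Mapping.lookup e v)"
  by (simp add: peval_def)

lemma monomial_value_add: "(\<Prod>v\<in>Poly_Mapping.keys (e + f). c v ^ Poly_Mapping.lookup (e + f) v) =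
  (\<Prod>v\<in>Poly_Mapping.keys e. c v ^ Poly_Mapping.lookup e v) * (\<Prod>v\<in>Poly_Mapping.keys f. (c v :: 'a::comm_semiring_1) ^ Poly_Mapping.lookup f v)"
proof -
  let ?A = "Poly_Mapping.keys e \<union> Poly_Mapping.keys f"
  have *: "(\<Prod>v\<in>Poly_Mapping.keys g. c v ^ Poly_Mapping.lookup g v) = (\<Prod>v\<in>?A. c v ^ Poly_Mapping.lookup g v)" if "Poly_Mapping.keys g \<subseteq> ?A" for g
    by (rule prod.mono_neutral_left) (use that in \<open>auto simp: in_keys_iff\<close>)
  show ?thesis using Poly_Mapping.keys_add[of e f]
    by (subst (1 2 3) *) (simp_all add: lookup_add power_add prod.distrib)
qed

lemma peval_mult: "peval c (p * q) = peval c p * peval c q"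
proof -
  have "peval c (p * q) = peval c ((\<Sum>a\<in>Poly_Mapping.keys p. Poly_Mapping.single a (Poly_Mapping.lookup p a)) * (\<Sum>a\<in>Poly_Mapping.keys q. Poly_Mapping.single a (Poly_Mapping.lookup q a)))"
    by (simp add: poly_mapping_sum_monomials)
  also have "\<dots> = peval c p * peval c q"
    unfolding sum_product peval_sum mult_single peval_single monomial_value_add
    by (simp add: peval_def sum_product mult_ac)
  finally show ?thesis .
qed

lemma peval_of_nat: "peval c (of_nat n) = of_nat n"
  by (induction n) (auto simp: peval_add peval_single single_one[symmetric] simp del: single_one)

lemma peval_var: "peval c (var v) = c v" by (simp add: var_def peval_single)

lemma lookup_subst: "Poly_Mapping.lookup (subst_params c p) e = peval c (Poly_Mapping.lookup p e)"
  by (simp add: subst_params_def map.rep_eq when_def)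

lemma subst_add: "subst_params c (p + q) = subst_params c p + subst_params c q"
  by (rule poly_mapping_eqI) (simp add: lookup_subst lookup_add peval_add)

lemma subst_zero [simp]: "subst_params c 0 = 0"
  by (rule poly_mapping_eqI) (simp add: lookup_subst)

lemma subst_sum: "subst_params c (sum f A) = (\<Sum>a\<in>A. subst_params c (f a))"
  by (induction A rule: infinite_finite_induct) (auto simp: subst_add)

lemma subst_single: "subst_params c (Poly_Mapping.single e a) = Poly_Mapping.single e (peval c a)"
  by (rule poly_mapping_eqI) (auto simp add: lookup_subst lookup_single when_def)

lemma subst_params_expand: "(\<Sum>a\<in>Poly_Mapping.keys p. Poly_Mapping.single a (peval c (Poly_Mapping.lookup p a))) = subst_params c p"
  by (subst (3) poly_mapping_sum_monomials[symmetric, of p]) (simp add: subst_sum subst_single)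

lemma subst_mult: "subst_params c (p * q) = subst_params c p * subst_params c q"
proof -
  have "subst_params c (p * q) = subst_params c ((\<Sum>a\<in>Poly_Mapping.keys p. Poly_Mapping.single a (Poly_Mapping.lookup p a)) * (\<Sum>a\<in>Poly_Mapping.keys q. Poly_Mapping.single a (Poly_Mapping.lookup q a)))"
    by (simp add: poly_mapping_sum_monomials)
  also have "\<dots> = subst_params c p * subst_params c q"
    unfolding sum_product subst_sum mult_single subst_single peval_mult
    by (simp add: sum_product subst_params_expand[symmetric] mult_single)
  finally show ?thesis .
qed

lemma subst_universal_coeff: "subst_params c (universal_coeff m M I i j) = (\<Sum>J\<in>multi_indices m M. Poly_Mapping.single J (c (I, J, i, j)))"
  by (simp add: universal_coeff_def subst_sum subst_single peval_var)

lemma lookup_pd: "Poly_Mapping.lookup (pd k p) e = of_nat (Suc (Poly_Mapping.lookup e k)) * Poly_Mapping.lookup p (e + Poly_Mapping.single k 1)"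
proof -
  have *: "(f - Poly_Mapping.single k 1 = e \<and> Poly_Mapping.lookup f k \<noteq> 0) = (f = e + Poly_Mapping.single k 1)" for f
    by (auto simp: poly_mapping_eq_iff fun_eq_iff lookup_add lookup_minus lookup_single when_def split: if_splits)
  have "Poly_Mapping.lookup (pd k p) e = (\<Sum>f\<in>Poly_Mapping.keys p. (if f = e + Poly_Mapping.single k 1 then of_nat (Poly_Mapping.lookup f k) * Poly_Mapping.lookup p f else 0))"
    unfolding pd_def lookup_sum
  proof (intro sum.cong refl, goal_cases)
    case (1 f)
    show ?case using *[of f] by (cases "Poly_Mapping.lookup f k = 0") (simp_all add: lookup_single when_def)
  qed
  then show ?thesis
    by (simp add: in_keys_iff lookup_add)
qed

lemma subst_pd: "subst_params c (pd k p) = pd k (subst_params c p)"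
  by (rule poly_mapping_eqI) (simp only: lookup_subst lookup_pd peval_mult peval_of_nat)

lemma subst_pd_pow: "subst_params c ((pd k ^^ n) p) = (pd k ^^ n) (subst_params c p)"
  by (induction n) (auto simp: subst_pd)

lemma subst_fold: "subst_params c (fold (\<lambda>k. pd k ^^ f k) ks p) = fold (\<lambda>k. pd k ^^ f k) ks (subst_params c p)"
  by (induction ks arbitrary: p) (auto simp: subst_pd_pow)

text \<open>Specialising the parameters commutes with applying the operators.\<close>

lemma subst_universal_op:
  "i < r \<Longrightarrow> subst_params c (universal_op m r N M P i) = special_op m r N M c (\<lambda>j. subst_params c (P j)) i"
  by (simp add: universal_op_def special_op_def diff_op_def subst_sum subst_mult pd_iter_def subst_fold)

text \<open>Hence the order of differentiation in \<open>pd_iter\<close> is immaterial.\<close>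

lemma pd_commute: "pd k (pd l p) = pd l (pd k (p :: ('v,'a::comm_semiring_1) mpoly))"
proof (cases "k = l")
  case False
  then show ?thesis by (intro poly_mapping_eqI) (simp add: lookup_pd lookup_add lookup_single ac_simps del: of_nat_Suc)
qed simp
end

theory Submission
  imports Defs "Jordan_Normal_Form.Determinant"
begin

text \<open>
  Fix a degree bound \<open>d\<close>. Applying \<open>D\<^sub>c\<close> to polynomial vectors of degree at most \<open>d\<close> and truncating
  the result to degree at most \<open>d\<close> is an endomorphism of a finite-dimensional space, whose matrix has
  entries linear in \<open>c\<close>. Its determinant is thus a polynomial in \<open>c\<close>, and it takes the value 1 at the
  parameter for which \<open>D\<^sub>c\<close> is the identity. Off the zero set of this determinant, \<open>D\<^sub>c\<close> is injective
  in degrees at most \<open>d\<close>; the countably many zero sets, one for each \<open>d\<close>, are the exceptional locus.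
\<close>

section \<open>Evaluation as a ring homomorphism, and closure of \<open>polys V\<close> under
  determinants\<close>

lemma comm_ring_hom_peval: "comm_ring_hom (peval (c :: 'v \<Rightarrow> 'a::comm_ring_1))"
proof
  show "peval c 1 = 1" using peval_of_nat[of c 1] by simp
qed (simp_all add: peval_add peval_mult)

lemma zero_in_polys [simp]: "0 \<in> polys V"
  by (simp add: polys_def)

lemma add_in_polys: "p \<in> polys V \<Longrightarrow> q \<in> polys V \<Longrightarrow> p + q \<in> polys V"
  using Poly_Mapping.keys_add[of p q] unfolding polys_def by blast

lemma mult_in_polys: "p \<in> polys V \<Longrightarrow> q \<in> polys V \<Longrightarrow> p * q \<in> polys V"
  unfolding polys_def by (auto dest!: subsetD[OF keys_mult] subsetD[OF Poly_Mapping.keys_add])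

lemma uminus_in_polys: "p \<in> polys V \<Longrightarrow> - p \<in> polys V" for p :: "('v, 'a::comm_ring_1) mpoly"
  by (simp add: polys_def in_keys_iff)

lemma const_in_polys: "Poly_Mapping.single 0 a \<in> polys V"
  by (simp add: polys_def)

lemma one_in_polys: "1 \<in> polys V"
  using const_in_polys[of 1] by simp

lemma var_in_polys: "v \<in> V \<Longrightarrow> var v \<in> polys V"
  by (simp add: polys_def var_def)

lemma sum_in_polys: "(\<And>a. a \<in> A \<Longrightarrow> f a \<in> polys V) \<Longrightarrow> sum f A \<in> polys V"
  by (induction A rule: infinite_finite_induct) (auto intro: add_in_polys)

lemma prod_in_polys: "(\<And>a. a \<in> A \<Longrightarrow> f a \<in> polys V) \<Longrightarrow> prod f A \<in> polys V"
  by (induction A rule: infinite_finite_induct) (auto intro: mult_in_polys one_in_polys)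

text \<open>Leibniz formula: the determinant is built from the entries by sums, products and signs.
  This makes it an admissible equation for \<open>zariski_closed\<close>.\<close>

lemma det_in_polys:
  fixes A :: "('v, 'a::comm_ring_1) mpoly mat"
  assumes "A \<in> carrier_mat n n" "\<And>i j. i < n \<Longrightarrow> j < n \<Longrightarrow> A $$ (i, j) \<in> polys V"
  shows "det A \<in> polys V"
  unfolding det_def'[OF assms(1)]
proof (rule sum_in_polys)
  fix p assume "p \<in> {p. p permutes {0..<n}}"
  then have "p i < n" if "i < n" for i
    using permutes_in_image[of p "{0..<n}" i] that by auto
  then have "(\<Prod>i = 0..<n. A $$ (i, p i)) \<in> polys V"
    by (intro prod_in_polys assms(2)) auto
  moreover have "(signof p :: ('v, 'a) mpoly) \<in> polys V"
    by (cases p rule: sign_cases) (auto intro: one_in_polys uminus_in_polys[OF one_in_polys])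
  ultimately show "signof p * (\<Prod>i = 0..<n. A $$ (i, p i)) \<in> polys V"
    by (rule mult_in_polys[rotated])
qed

section \<open>Linearity of iterated derivatives over constants\<close>

lemma lookup_const_mult: "Poly_Mapping.lookup (Poly_Mapping.single 0 a * p) e = a * Poly_Mapping.lookup p e"
proof -
  have "Poly_Mapping.single 0 a * p =
      (\<Sum>f\<in>Poly_Mapping.keys p. Poly_Mapping.single f (a * Poly_Mapping.lookup p f))"
    by (subst poly_mapping_sum_monomials[of p, symmetric]) (simp add: sum_distrib_left mult_single)
  then show ?thesis
    by (simp add: lookup_sum lookup_single when_def in_keys_iff)
qed

lemma pd_add: "pd k (p + q) = pd k p + pd k q"
  by (rule poly_mapping_eqI) (simp add: lookup_pd lookup_add distrib_left)

lemma pd_const_mult: "pd k (Poly_Mapping.single 0 a * p) = Poly_Mapping.single 0 a * pd k p"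
  by (rule poly_mapping_eqI) (simp only: lookup_pd lookup_const_mult mult.left_commute)

lemma pd_iter_add: "pd_iter m I (p + q) = pd_iter m I p + pd_iter m I q"
proof -
  have "(pd k ^^ n) (p + q) = (pd k ^^ n) p + (pd k ^^ n) q" for k n and p q :: "(nat, 'a) mpoly"
    by (induction n) (simp_all add: pd_add)
  then have "fold (\<lambda>k. pd k ^^ f k) ks (p + q) =
      fold (\<lambda>k. pd k ^^ f k) ks p + fold (\<lambda>k. pd k ^^ f k) ks q" for f ks and p q :: "(nat, 'a) mpoly"
    by (induction ks arbitrary: p q) simp_all
  then show ?thesis by (simp add: pd_iter_def)
qed

lemma pd_iter_const_mult: "pd_iter m I (Poly_Mapping.single 0 a * p) = Poly_Mapping.single 0 a * pd_iter m I p"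
proof -
  have "(pd k ^^ n) (Poly_Mapping.single 0 a * p) = Poly_Mapping.single 0 a * (pd k ^^ n) p"
    for k n and p :: "(nat, 'a) mpoly"
    by (induction n) (simp_all add: pd_const_mult)
  then have "fold (\<lambda>k. pd k ^^ f k) ks (Poly_Mapping.single 0 a * p) =
      Poly_Mapping.single 0 a * fold (\<lambda>k. pd k ^^ f k) ks p" for f ks and p :: "(nat, 'a) mpoly"
    by (induction ks arbitrary: p) simp_all
  then show ?thesis by (simp add: pd_iter_def)
qed

lemma pd_iter_zero_index: "pd_iter m 0 p = p"
proof -
  have "fold (\<lambda>k. pd k ^^ 0) ks p = p" for ks
    by (induction ks) simp_all
  then show ?thesis by (simp add: pd_iter_def)
qed

lemma pd_iter_zero: "pd_iter m I 0 = 0"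
  using pd_iter_const_mult[of m I 0 0] by simp

section \<open>Matrix entries of the operator, linear in the parameters\<close>

definition op_coeff ::
  "nat \<Rightarrow> (nat \<Rightarrow>\<^sub>0 nat) \<Rightarrow> (nat \<Rightarrow>\<^sub>0 nat) \<Rightarrow> (nat \<Rightarrow>\<^sub>0 nat) \<Rightarrow> (nat, 'a::comm_semiring_1) mpoly \<Rightarrow> 'a" where
  "op_coeff m I J F p = Poly_Mapping.lookup (Poly_Mapping.single J 1 * pd_iter m I p) F"

lemma op_coeff_add: "op_coeff m I J F (p + q) = op_coeff m I J F p + op_coeff m I J F q"
  by (simp add: op_coeff_def pd_iter_add distrib_left lookup_add)

lemma op_coeff_const_mult: "op_coeff m I J F (Poly_Mapping.single 0 a * p) = a * op_coeff m I J F p"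
  unfolding op_coeff_def pd_iter_const_mult
  by (subst mult.left_commute) (rule lookup_const_mult)

lemma op_coeff_sum: "op_coeff m I J F (sum f A) = (\<Sum>a\<in>A. op_coeff m I J F (f a))"
proof -
  have "op_coeff m I J F 0 = 0"
    by (simp add: op_coeff_def pd_iter_zero)
  then show ?thesis
    by (induction A rule: infinite_finite_induct) (auto simp: op_coeff_add)
qed

text \<open>Linearity applied to the monomial expansion of \<open>p\<close>. Since \<open>B\<close>
  may exceed the support, all polynomials of bounded degree can share one basis.\<close>

lemma op_coeff_expand:
  assumes "finite B" "Poly_Mapping.keys p \<subseteq> B"
  shows "op_coeff m I J F p =
    (\<Sum>E\<in>B. Poly_Mapping.lookup p E * op_coeff m I J F (Poly_Mapping.single E 1))"
proof -
  have "p = (\<Sum>E\<in>Poly_Mapping.keys p. Poly_Mapping.single E (Poly_Mapping.lookup p E))"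
    by (rule poly_mapping_sum_monomials[symmetric])
  also have "\<dots> = (\<Sum>E\<in>B. Poly_Mapping.single E (Poly_Mapping.lookup p E))"
    by (rule sum.mono_neutral_left) (use assms in \<open>auto simp: in_keys_iff\<close>)
  also have "\<dots> = (\<Sum>E\<in>B. Poly_Mapping.single 0 (Poly_Mapping.lookup p E) * Poly_Mapping.single E 1)"
    by (simp add: mult_single)
  finally show ?thesis
    by (metis (no_types, lifting) op_coeff_sum op_coeff_const_mult sum.cong)
qed

text \<open>Separates the parameters from the rest: \<open>c\<close> enters only through scalar
  factors, while the factors \<open>op_coeff\<close> do not involve it.\<close>

lemma lookup_special_op:
  assumes "i < r"
  shows "Poly_Mapping.lookup (special_op m r N M c P i) F =
    (\<Sum>j<r. \<Sum>I\<in>multi_indices m N. \<Sum>J\<in>multi_indices m M. c (I, J, i, j) * op_coeff m I J F (P j))"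
proof -
  have *: "Poly_Mapping.single J a * q = Poly_Mapping.single 0 a * (Poly_Mapping.single J 1 * q)"
    for J a and q :: "(nat, 'a) mpoly"
    by (simp add: mult.assoc[symmetric] mult_single)
  have **: "Poly_Mapping.lookup (Poly_Mapping.single J a * q) F =
      a * Poly_Mapping.lookup (Poly_Mapping.single J 1 * q) F" for J a and q :: "(nat, 'a) mpoly"
    by (subst *) (rule lookup_const_mult)
  have "Poly_Mapping.lookup (special_op m r N M c P i) F =
    (\<Sum>j<r. \<Sum>I\<in>multi_indices m N. \<Sum>J\<in>multi_indices m M.
       Poly_Mapping.lookup (Poly_Mapping.single J (c (I, J, i, j)) * pd_iter m I (P j)) F)"
    using assms by (simp add: special_op_def diff_op_def subst_universal_coeff lookup_sum sum_distrib_right)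
  then show ?thesis
    \<comment> \<open>The instantiation of \<open>a\<close> prevents a loop: the right side of
      \<open>**\<close> contains an instance of its left side with \<open>a = 1\<close>.\<close>
    unfolding op_coeff_def by (simp only: **[where a = "c x" for x])
qed

text \<open>Column \<open>(j, E)\<close> stands for the basis vector with \<open>x^E\<close> in
  component \<open>j\<close>, row \<open>(i, F)\<close> for the coefficient of \<open>x^F\<close> in
  component \<open>i\<close> of the image. The entry is kept as a formal polynomial in the
  parameters so that the determinant is one too.\<close>

definition op_entry ::
  "nat \<Rightarrow> nat \<Rightarrow> nat \<Rightarrow> nat \<times> (nat \<Rightarrow>\<^sub>0 nat) \<Rightarrow> nat \<times> (nat \<Rightarrow>\<^sub>0 nat) \<Rightarrow> (param, 'a::comm_semiring_1) mpoly" where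
  "op_entry m N M = (\<lambda>(i, F) (j, E). \<Sum>I\<in>multi_indices m N. \<Sum>J\<in>multi_indices m M.
     var (I, J, i, j) * Poly_Mapping.single 0 (op_coeff m I J F (Poly_Mapping.single E 1)))"

lemma op_entry_in_polys: "i < r \<Longrightarrow> j < r \<Longrightarrow> op_entry m N M (i, F) (j, E) \<in> polys (params m r N M)"
  unfolding op_entry_def split
  by (intro sum_in_polys mult_in_polys const_in_polys var_in_polys) (simp add: params_def)

lemma peval_op_entry: "peval c (op_entry m N M (i, F) (j, E)) =
  (\<Sum>I\<in>multi_indices m N. \<Sum>J\<in>multi_indices m M.
     c (I, J, i, j) * op_coeff m I J F (Poly_Mapping.single E 1))"
  by (simp add: op_entry_def peval_sum peval_mult peval_var peval_single)

text \<open>The operator as a matrix-vector product. The degree bound limits only the columns;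
  \<open>F\<close> is arbitrary, and truncation will consist in keeping only the rows of degree at
  most \<open>d\<close>.\<close>

lemma lookup_special_op_entries:
  assumes "i < r" "\<And>j. j < r \<Longrightarrow> Poly_Mapping.keys (P j) \<subseteq> multi_indices m d"
  shows "Poly_Mapping.lookup (special_op m r N M c P i) F =
    (\<Sum>(j, E)\<in>{..<r} \<times> multi_indices m d. peval c (op_entry m N M (i, F) (j, E)) * Poly_Mapping.lookup (P j) E)"
proof -
  have "(\<Sum>I\<in>multi_indices m N. \<Sum>J\<in>multi_indices m M. c (I, J, i, j) * op_coeff m I J F (P j)) =
      (\<Sum>E\<in>multi_indices m d. peval c (op_entry m N M (i, F) (j, E)) * Poly_Mapping.lookup (P j) E)"
    if "j < r" for j
  proof -
    let ?t = "\<lambda>I J E. c (I, J, i, j) * op_coeff m I J F (Poly_Mapping.single E 1) * Poly_Mapping.lookup (P j) E"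
    have "(\<Sum>I\<in>multi_indices m N. \<Sum>J\<in>multi_indices m M. c (I, J, i, j) * op_coeff m I J F (P j)) =
        (\<Sum>I\<in>multi_indices m N. \<Sum>J\<in>multi_indices m M. \<Sum>E\<in>multi_indices m d. ?t I J E)"
      by (simp add: op_coeff_expand[OF finite_multi_indices assms(2)[OF that]] sum_distrib_left mult_ac)
    also have "\<dots> = (\<Sum>I\<in>multi_indices m N. \<Sum>E\<in>multi_indices m d. \<Sum>J\<in>multi_indices m M. ?t I J E)"
      by (rule sum.cong[OF refl]) (rule sum.swap)
    also have "\<dots> = (\<Sum>E\<in>multi_indices m d. \<Sum>I\<in>multi_indices m N. \<Sum>J\<in>multi_indices m M. ?t I J E)"
      by (rule sum.swap)
    finally show ?thesis
      by (simp add: peval_op_entry sum_distrib_right)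
  qed
  then show ?thesis
    by (simp add: lookup_special_op[OF assms(1)] sum.cartesian_product[symmetric])
qed

section \<open>The parameter at which the operator is the identity\<close>

definition identity_param :: "nat \<Rightarrow> nat \<Rightarrow> nat \<Rightarrow> nat \<Rightarrow> param \<Rightarrow> 'a::comm_semiring_1" where
  "identity_param m r N M =
     (\<lambda>(I, J, i, j)\<in>params m r N M. if I = 0 \<and> J = 0 \<and> i = j then 1 else 0)"

lemma identity_param_in_affine_space: "identity_param m r N M \<in> affine_space (params m r N M)"
  by (simp add: identity_param_def affine_space_def)

text \<open>Ensures that the identity operator belongs to the family for all \<open>N\<close> and
  \<open>M\<close>, including 0.\<close>

lemma zero_in_multi_indices: "0 \<in> multi_indices m d"
  by (simp add: multi_indices_def)

lemma peval_identity_param_op_entry: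
  assumes "i < r" "j < r"
  shows "peval (identity_param m r N M) (op_entry m N M (i, F) (j, E)) =
    (if (i, F) = (j, E) then 1 else 0)"
proof -
  have "peval (identity_param m r N M) (op_entry m N M (i, F) (j, E)) =
      (\<Sum>I\<in>multi_indices m N. \<Sum>J\<in>multi_indices m M.
        if I = 0 then if J = 0 then if i = j then op_coeff m 0 0 F (Poly_Mapping.single E 1) else 0 else 0 else 0)"
    unfolding peval_op_entry
    by (intro sum.cong refl) (use assms in \<open>auto simp: identity_param_def params_def\<close>)
  also have "\<dots> = (if i = j then op_coeff m 0 0 F (Poly_Mapping.single E 1) else 0)"
    \<comment> \<open>After the swap the inner sum runs over \<open>I\<close>, the index tested
      first, so the two sums collapse one after the other.\<close>
    by (subst sum.swap) (simp add: finite_multi_indices zero_in_multi_indices)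
  also have "\<dots> = (if (i, F) = (j, E) then 1 else 0)"
    by (auto simp: op_coeff_def pd_iter_zero_index lookup_single when_def)
  finally show ?thesis .
qed

section \<open>The determinant in a fixed degree\<close>

lemma ex_polynomial_detecting_kernel:
  fixes m r N M d :: nat
  obtains f :: "(param, 'a::field) mpoly"
  where "f \<in> polys (params m r N M)" "peval (identity_param m r N M) f = 1"
    "\<And>c P i. peval c f \<noteq> 0 \<Longrightarrow> (\<And>j. j < r \<Longrightarrow> Poly_Mapping.keys (P j) \<subseteq> multi_indices m d) \<Longrightarrow>
       (\<And>j. j < r \<Longrightarrow> special_op m r N M c P j = 0) \<Longrightarrow> i < r \<Longrightarrow> P i = 0"
proof -
  \<comment> \<open>\<open>S\<close> indexes both rows and columns, which makes the matrix square.
    Images may have degree above \<open>d\<close>, but dropping those coefficients only enlarges the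
    kernel, so invertibility of the truncation suffices.\<close>
  define S where "S = {..<r} \<times> multi_indices m d"
  define n where "n = card S"
  have "finite S" by (simp add: S_def finite_multi_indices)
  then obtain s where s: "bij_betw s {0..<n} S"
    unfolding n_def using ex_bij_betw_nat_finite by blast
  define A :: "(param, 'a) mpoly mat" where "A = mat n n (\<lambda>(a, b). op_entry m N M (s a) (s b))"
  have A: "A \<in> carrier_mat n n" by (simp add: A_def)
  have sS: "s a \<in> S" if "a < n" for a
    using bij_betwE[OF s] that by simp
  have fst_s: "fst (s a) < r" if "a < n" for a
    using sS[OF that] by (auto simp: S_def)
  have det_A: "det (map_mat (peval c) A) = peval c (det A)" for c
    using comm_ring_hom.hom_det[OF comm_ring_hom_peval] .
  show ?thesis
  proof
    show "det A \<in> polys (params m r N M)"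
    proof (rule det_in_polys[OF A])
      fix a b assume "a < n" "b < n"
      then show "A $$ (a, b) \<in> polys (params m r N M)"
        using op_entry_in_polys[OF fst_s fst_s, of a b m N M "snd (s a)" "snd (s b)"] by (simp add: A_def)
    qed
    have "map_mat (peval (identity_param m r N M)) A = 1\<^sub>m n"
    proof (rule eq_matI)
      fix a b assume "a < dim_row (1\<^sub>m n :: 'a mat)" "b < dim_col (1\<^sub>m n :: 'a mat)"
      then have ab: "a < n" "b < n" by simp_all
      then have "s a = s b \<longleftrightarrow> a = b"
        using s by (auto simp: bij_betw_def inj_on_def)
      then show "map_mat (peval (identity_param m r N M)) A $$ (a, b) = (1\<^sub>m n :: 'a mat) $$ (a, b)"
        using peval_identity_param_op_entry[OF fst_s fst_s, of a b m N M "snd (s a)" "snd (s b)"] ab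
        by (simp add: A_def)
    qed (simp_all add: A_def)
    then show "peval (identity_param m r N M) (det A) = 1"
      by (simp flip: det_A)
    fix c P i
    assume nz: "peval c (det A) \<noteq> 0"
      and P: "\<And>j. j < r \<Longrightarrow> Poly_Mapping.keys (P j) \<subseteq> multi_indices m d"
      and D: "\<And>j. j < r \<Longrightarrow> special_op m r N M c P j = 0"
      and i: "i < r"
    \<comment> \<open>The coordinates of \<open>P\<close> in the monomial basis enumerated by
      \<open>s\<close>.\<close>
    define v where "v = vec n (\<lambda>b. Poly_Mapping.lookup (P (fst (s b))) (snd (s b)))"
    have v: "v \<in> carrier_vec n" by (simp add: v_def)
    \<comment> \<open>Each row of the product is a coefficient of the image of \<open>P\<close>,
      which vanishes by \<open>D\<close>.\<close>
    have "map_mat (peval c) A *\<^sub>v v = 0\<^sub>v n"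
    proof (rule eq_vecI)
      fix a assume "a < dim_vec (0\<^sub>v n :: 'a vec)"
      then have a: "a < n" by simp
      obtain k F where kF: "s a = (k, F)" by force
      with fst_s[OF a] have k: "k < r" by simp
      have "(map_mat (peval c) A *\<^sub>v v) $ a =
          (\<Sum>b = 0..<n. peval c (op_entry m N M (s a) (s b)) * Poly_Mapping.lookup (P (fst (s b))) (snd (s b)))"
        using a by (simp add: A_def v_def scalar_prod_def)
      also have "\<dots> = (\<Sum>x\<in>S. peval c (op_entry m N M (s a) x) * Poly_Mapping.lookup (P (fst x)) (snd x))"
        by (rule sum.reindex_bij_betw[OF s])
      also have "\<dots> = Poly_Mapping.lookup (special_op m r N M c P k) F"
        unfolding S_def kF lookup_special_op_entries[where P = P, OF k P, simplified] by (simp add: case_prod_beta)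
      finally show "(map_mat (peval c) A *\<^sub>v v) $ a = 0\<^sub>v n $ a"
        using D[OF k] a by simp
    qed (simp add: A_def)
    then have v0: "v = 0\<^sub>v n"
      using det_0_iff_vec_prod_zero_field[of "map_mat (peval c) A" n] A v nz det_A by auto
    show "P i = 0"
    proof (rule poly_mapping_eqI)
      fix E
      show "Poly_Mapping.lookup (P i) E = Poly_Mapping.lookup 0 E"
      \<comment> \<open>Coefficients within the degree bound are entries of \<open>v\<close>; the
        others vanish by the bound on \<open>P\<close>.\<close>
      proof (cases "E \<in> multi_indices m d")
        case True
        then have "(i, E) \<in> s ` {0..<n}"
          using s i by (simp add: bij_betw_def S_def)
        then obtain b where "b < n" "s b = (i, E)" by auto
        then show ?thesis
          using arg_cong[OF v0, of "\<lambda>w. w $ b"] by (simp add: v_def)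
      next
        case False
        then show ?thesis using P[OF i] by (auto simp: in_keys_iff)
      qed
    qed
  qed
qed

section \<open>From bounded degree to all polynomial vectors\<close>

lemma ex_degree_bound:
  assumes "P \<in> poly_vectors m r"
  obtains d where "\<And>j. j < r \<Longrightarrow> Poly_Mapping.keys (P j) \<subseteq> multi_indices m d"
proof
  define T where "T = (\<Union>j<r. Poly_Mapping.keys (P j))"
  \<comment> \<open>A crude bound: the sum of all total degrees dominates each of them and also
    makes sense when \<open>T\<close> is empty.\<close>
  define d where "d = (\<Sum>e\<in>T. \<Sum>k<m. Poly_Mapping.lookup e k)"
  have "finite T" by (simp add: T_def)
  fix j assume j: "j < r"
  show "Poly_Mapping.keys (P j) \<subseteq> multi_indices m d"
  proof
    fix e assume e: "e \<in> Poly_Mapping.keys (P j)"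
    then have "e \<in> T" using j by (auto simp: T_def)
    then have "(\<Sum>k<m. Poly_Mapping.lookup e k) \<le> d"
      unfolding d_def using \<open>finite T\<close>
      by (intro member_le_sum[of e T "\<lambda>e. \<Sum>k<m. Poly_Mapping.lookup e k"]) simp_all
    moreover have "P j \<in> polys {..<m}"
      using assms j by (auto simp: poly_vectors_def)
    ultimately show "e \<in> multi_indices m d"
      using e by (auto simp: multi_indices_def polys_def)
  qed
qed

lemma special_op_zero_vector: "special_op m r N M c (zero_vector r) = zero_vector r"
  by (auto simp: special_op_def diff_op_def zero_vector_def pd_iter_zero)

lemma zero_vector_in_poly_vectors: "zero_vector r \<in> poly_vectors m r"
  by (simp add: zero_vector_def poly_vectors_def)

text \<open>Both sides are extensional, so they already agree outside \<open>{..<r}\<close>.\<close>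

lemma poly_vectors_eq_zero_vector:
  "P \<in> poly_vectors m r \<Longrightarrow> (\<And>i. i < r \<Longrightarrow> P i = 0) \<Longrightarrow> P = zero_vector r"
  unfolding poly_vectors_def zero_vector_def by (auto simp: PiE_iff extensional_def)

text \<open>The determinant for degree \<open>d\<close> excludes only kernel elements of degree at
  most \<open>d\<close>. Every polynomial vector has some degree bound, so avoiding the countably
  many zero sets \<open>Z d\<close> excludes all nonzero ones.\<close>

lemma very_general_kernel_zero:
  "very_general (params m r N M)
     (\<lambda>c :: param \<Rightarrow> 'k::field. op_kernel m r (special_op m r N M c) = {zero_vector r})"
proof -
  let ?V = "params m r N M" and ?c1 = "identity_param m r N M :: param \<Rightarrow> 'k"
  \<comment> \<open>The quantifier order matters: \<open>f d\<close> is chosen before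
    \<open>c\<close> and \<open>P\<close>, so its zero set depends on \<open>d\<close>
    alone.\<close>
  have "\<exists>f :: nat \<Rightarrow> (param, 'k) mpoly. \<forall>d. f d \<in> polys ?V \<and> peval ?c1 (f d) = 1 \<and>
      (\<forall>c P i. peval c (f d) \<noteq> 0 \<longrightarrow> (\<forall>j<r. Poly_Mapping.keys (P j) \<subseteq> multi_indices m d) \<longrightarrow>
         (\<forall>j<r. special_op m r N M c P j = 0) \<longrightarrow> i < r \<longrightarrow> P i = 0)"
    by (intro choice allI) (rule ex_polynomial_detecting_kernel; blast)
  then obtain f :: "nat \<Rightarrow> (param, 'k) mpoly" where f: "\<And>d. f d \<in> polys ?V" "\<And>d. peval ?c1 (f d) = 1"
    and inj: "\<And>d c P i. peval c (f d) \<noteq> 0 \<Longrightarrow> (\<forall>j<r. Poly_Mapping.keys (P j) \<subseteq> multi_indices m d) \<Longrightarrow>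
         (\<forall>j<r. special_op m r N M c P j = 0) \<Longrightarrow> i < r \<Longrightarrow> P i = 0"
    by blast
  define Z where "Z d = {c \<in> affine_space ?V. \<forall>g\<in>{f d}. peval c g = 0}" for d
  have "zariski_closed ?V (Z d)" for d
    unfolding zariski_closed_def Z_def using f(1) by (intro exI[of _ "{f d}"]) simp
  moreover have "Z d \<noteq> affine_space ?V" for d
  proof -
    \<comment> \<open>The identity parameter is a single witness that every \<open>Z d\<close> is
      proper.\<close>
    have "?c1 \<notin> Z d" using f(2) by (simp add: Z_def)
    then show ?thesis using identity_param_in_affine_space by metis
  qed
  moreover have "op_kernel m r (special_op m r N M c) = {zero_vector r}"
    if c: "c \<in> affine_space ?V - \<Union>(range Z)" for c
  proof -
    have nz: "peval c (f d) \<noteq> 0" for d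
      using c by (auto simp: Z_def)
    have "P = zero_vector r" if P: "P \<in> poly_vectors m r" "special_op m r N M c P = zero_vector r" for P
    proof -
      obtain d where d: "\<And>j. j < r \<Longrightarrow> Poly_Mapping.keys (P j) \<subseteq> multi_indices m d"
        using ex_degree_bound[OF P(1)] by blast
      have "\<forall>j<r. special_op m r N M c P j = 0"
        using P(2) by (simp add: zero_vector_def)
      then have "P i = 0" if "i < r" for i
        using inj[OF nz] d that by blast
      then show ?thesis
        by (rule poly_vectors_eq_zero_vector[OF P(1)])
    qed
    then show ?thesis
      using zero_vector_in_poly_vectors special_op_zero_vector by (auto simp: op_kernel_def)
  qed
  ultimately show ?thesis
    unfolding very_general_def by (intro exI[of _ "range Z"]) auto
qed

lemma very_general_mono: "very_general V Q \<Longrightarrow> (\<And>c. Q c \<Longrightarrow> R c) \<Longrightarrow> very_general V R"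
  unfolding very_general_def by (erule ex_forward) simp

theorem theorem4p13:
  fixes m r N M :: nat
  assumes "uncountable (UNIV :: 'k::field set)"
    and "m \<ge> 1" and "r \<ge> 1"
  shows "very_general (params m r N M)
           (\<lambda>c :: param \<Rightarrow> 'k. op_kernel m r (special_op m r N M c) = {zero_vector r})
       \<and> (m = 1 \<longrightarrow> very_general (params 1 r N M)
           (\<lambda>c :: param \<Rightarrow> 'k. \<not> (\<exists>P \<in> poly_vectors 1 r.
              P \<noteq> zero_vector r \<and> special_op 1 r N M c P = zero_vector r)))"
proof (intro conjI impI)
  show "very_general (params m r N M)
      (\<lambda>c :: param \<Rightarrow> 'k. op_kernel m r (special_op m r N M c) = {zero_vector r})"
    by (rule very_general_kernel_zero)
  have "\<not> (\<exists>P \<in> poly_vectors 1 r. P \<noteq> zero_vector r \<and> special_op 1 r N M c P = zero_vector r)"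
    if "op_kernel 1 r (special_op 1 r N M c) = {zero_vector r}" for c :: "param \<Rightarrow> 'k"
    using that by (auto simp: op_kernel_def)
  then show "very_general (params 1 r N M)
      (\<lambda>c :: param \<Rightarrow> 'k. \<not> (\<exists>P \<in> poly_vectors 1 r.
         P \<noteq> zero_vector r \<and> special_op 1 r N M c P = zero_vector r))"
    by (rule very_general_mono[OF very_general_kernel_zero])
qed

end
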